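(* Every right-angled Artin--Tits presentation $(S,R)$ satisfies Property H: for every word $w$ of $\mathcal W(S)$ that represents $1$ in the group $\langle S\mid R\rangle$, the relation $w\rightsquigarrow^{0,1,2}_R\varepsilon$ holds.
   Context: For a set $S$, $\mathcal W^+(S)$ is the free monoid of all words in the alphabet $S$, and $\mathcal W(S)$ is the free monoid of all words in $S\sqcup S^{-1}$, where $S^{-1}$ is a disjoint copy of $S$ with one letter $s^{-1}$ for each $s\in S$. The empty word is $\varepsilon$; $w^{-1}$ is obtained from $w$ by exchanging $s$ and $s^{-1}$ everywhere and reversing the order of letters. A factor of a word is a contiguous subword. $\langle S\mid R\rangle$ is the group presented by $(S,R)$; relations $v=v'$ of $R$ are unoriented. A right-angled Artin--Tits presentation is a presentation $(S,R)$ in which $R$ consists only of commutation relations $st=ts$ with $s\neq t$ in $S$. Special transformations on words of $\mathcal W(S)$: - type $0$: remove some pair $s^{-1}s$ or $ss^{-1}$ with $s\in S$; - type $1$: replace some factor $v$ by $v'$, or $v^{-1}$ by $v'^{-1}$, where $v=v'$ is a relation of $R$; - type $2_r$: replace some factor $v^{-1}v'$ by $uu'^{-1}$, where $v,v'$ are nonempty words of $\mathcal W^+(S)$ and $vu=v'u'$ is a relation of $R$; - type $2_\ell$: replace some factor $vv'^{-1}$ by $u^{-1}u'$, where $v,v'$ are nonempty words of $\mathcal W^+(S)$ and $uv=u'v'$ is a relation of $R$. Type $2$ means $2_r$ or $2_\ell$. One writes $w\rightsquigarrow^{0,1,2}_R w'$ if $w$ can be transformed to $w'$ by a finite (possibly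 empty) sequence of special transformations of types $0$, $1$, $2$. *)

theory Defs
  imports "HOL-Algebra.Group"
begin

section \<open>Words\<close>

text \<open>The free monoid of positive words over \<open>S\<close> is \<^term>\<open>lists S\<close>;
  \<open>Neg s\<close> is the formal inverse letter of \<open>s\<close>.\<close>

datatype 'a letter = Pos 'a | Neg 'a

primrec letter_inv :: "'a letter \<Rightarrow> 'a letter" where
  "letter_inv (Pos s) = Neg s"
| "letter_inv (Neg s) = Pos s"

definition signed_words :: "'a set \<Rightarrow> 'a letter list set" where
  "signed_words S = lists (Pos ` S \<union> Neg ` S)"

definition word_inv :: "'a letter list \<Rightarrow> 'a letter list" where
  "word_inv w = rev (map letter_inv w)"

abbreviation pos :: "'a list \<Rightarrow> 'a letter list" where
  "pos v \<equiv> map Pos v"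

section \<open>Presentations and presented groups\<close>

definition presentation :: "'a set \<Rightarrow> ('a list \<times> 'a list) set \<Rightarrow> bool" where
  "presentation S R \<longleftrightarrow> R \<subseteq> lists S \<times> lists S"

text \<open>Relations are unoriented: a pair \<open>(v, v')\<close> in \<open>R\<close> stands for both
  \<open>v = v'\<close> and \<open>v' = v\<close>.\<close>

definition is_relation :: "('a list \<times> 'a list) set \<Rightarrow> 'a list \<Rightarrow> 'a list \<Rightarrow> bool" where
  "is_relation R v v' \<longleftrightarrow> (v, v') \<in> R \<or> (v', v) \<in> R"

text \<open>The least congruence on the monoid of signed words containing the relations of \<open>R\<close>
  and all pairs \<open>(s s\<inverse>, \<epsilon>)\<close>, \<open>(s\<inverse> s, \<epsilon>)\<close>.\<close>

inductive_set word_cong :: "'a set \<Rightarrow> ('a list \<times> 'a list) set \<Rightarrow> ('a letter list \<times> 'a letter list) set"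
  for S R where
  refl: "w \<in> signed_words S \<Longrightarrow> (w, w) \<in> word_cong S R"
| sym: "(w, w') \<in> word_cong S R \<Longrightarrow> (w', w) \<in> word_cong S R"
| trans: "(w, w') \<in> word_cong S R \<Longrightarrow> (w', w'') \<in> word_cong S R \<Longrightarrow> (w, w'') \<in> word_cong S R"
| append: "(w, w') \<in> word_cong S R \<Longrightarrow> (z, z') \<in> word_cong S R \<Longrightarrow> (w @ z, w' @ z') \<in> word_cong S R"
| rel: "(v, v') \<in> R \<Longrightarrow> (pos v, pos v') \<in> word_cong S R"
| cancel_right: "s \<in> S \<Longrightarrow> ([Pos s, Neg s], []) \<in> word_cong S R"
| cancel_left: "s \<in> S \<Longrightarrow> ([Neg s, Pos s], []) \<in> word_cong S R"

definition word_class :: "'a set \<Rightarrow> ('a list \<times> 'a list) set \<Rightarrow> 'a letter list \<Rightarrow> 'a letter list set" where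
  "word_class S R w = word_cong S R `` {w}"

definition presented_group :: "'a set \<Rightarrow> ('a list \<times> 'a list) set \<Rightarrow> 'a letter list set monoid" where
  "presented_group S R =
     \<lparr>carrier = signed_words S // word_cong S R,
      mult = (\<lambda>A B. \<Union>u\<in>A. \<Union>v\<in>B. word_class S R (u @ v)),
      one = word_class S R []\<rparr>"

definition represents_one :: "'a set \<Rightarrow> ('a list \<times> 'a list) set \<Rightarrow> 'a letter list \<Rightarrow> bool" where
  "represents_one S R w \<longleftrightarrow> word_class S R w = \<one>\<^bsub>presented_group S R\<^esub>"

section \<open>Special transformations\<close>

inductive special_step :: "'a set \<Rightarrow> ('a list \<times> 'a list) set \<Rightarrow> 'a letter list \<Rightarrow> 'a letter list \<Rightarrow> bool"
  for S R where
  type0_left: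
    "s \<in> S \<Longrightarrow> x \<in> signed_words S \<Longrightarrow> y \<in> signed_words S \<Longrightarrow>
     special_step S R (x @ [Neg s, Pos s] @ y) (x @ y)"
| type0_right:
    "s \<in> S \<Longrightarrow> x \<in> signed_words S \<Longrightarrow> y \<in> signed_words S \<Longrightarrow>
     special_step S R (x @ [Pos s, Neg s] @ y) (x @ y)"
| type1_pos:
    "is_relation R v v' \<Longrightarrow> x \<in> signed_words S \<Longrightarrow> y \<in> signed_words S \<Longrightarrow>
     special_step S R (x @ pos v @ y) (x @ pos v' @ y)"
| type1_neg:
    "is_relation R v v' \<Longrightarrow> x \<in> signed_words S \<Longrightarrow> y \<in> signed_words S \<Longrightarrow>
     special_step S R (x @ word_inv (pos v) @ y) (x @ word_inv (pos v') @ y)"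
| type2_right:
    "v \<in> lists S \<Longrightarrow> v' \<in> lists S \<Longrightarrow> v \<noteq> [] \<Longrightarrow> v' \<noteq> [] \<Longrightarrow> is_relation R (v @ u) (v' @ u') \<Longrightarrow>
     x \<in> signed_words S \<Longrightarrow> y \<in> signed_words S \<Longrightarrow>
     special_step S R (x @ word_inv (pos v) @ pos v' @ y) (x @ pos u @ word_inv (pos u') @ y)"
| type2_left:
    "v \<in> lists S \<Longrightarrow> v' \<in> lists S \<Longrightarrow> v \<noteq> [] \<Longrightarrow> v' \<noteq> [] \<Longrightarrow> is_relation R (u @ v) (u' @ v') \<Longrightarrow>
     x \<in> signed_words S \<Longrightarrow> y \<in> signed_words S \<Longrightarrow>
     special_step S R (x @ pos v @ word_inv (pos v') @ y) (x @ word_inv (pos u) @ pos u' @ y)"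

definition special_reduces :: "'a set \<Rightarrow> ('a list \<times> 'a list) set \<Rightarrow> 'a letter list \<Rightarrow> 'a letter list \<Rightarrow> bool" where
  "special_reduces S R = (special_step S R)\<^sup>*\<^sup>*"

definition property_H :: "'a set \<Rightarrow> ('a list \<times> 'a list) set \<Rightarrow> bool" where
  "property_H S R \<longleftrightarrow>
     (\<forall>w \<in> signed_words S. represents_one S R w \<longrightarrow> special_reduces S R w [])"

definition right_angled_artin_tits :: "'a set \<Rightarrow> ('a list \<times> 'a list) set \<Rightarrow> bool" where
  "right_angled_artin_tits S R \<longleftrightarrow> R \<subseteq> {([s, t], [t, s]) | s t. s \<in> S \<and> t \<in> S \<and> s \<noteq> t}"

lemma right_angled_artin_tits_presentation:
  "right_angled_artin_tits S R \<Longrightarrow> presentation S R"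
  unfolding right_angled_artin_tits_def presentation_def by auto

section \<open>The presented group is a group with the expected universal property\<close>

lemma signed_words_simps [simp]:
  "[] \<in> signed_words S"
  "a # w \<in> signed_words S \<longleftrightarrow> a \<in> Pos ` S \<union> Neg ` S \<and> w \<in> signed_words S"
  "w @ z \<in> signed_words S \<longleftrightarrow> w \<in> signed_words S \<and> z \<in> signed_words S"
  by (auto simp: signed_words_def)

lemma pos_in_signed_words: "v \<in> lists S \<Longrightarrow> pos v \<in> signed_words S"
  by (induction v) auto

lemma word_inv_in_signed_words: "w \<in> signed_words S \<Longrightarrow> word_inv w \<in> signed_words S"
  by (induction w) (auto simp: word_inv_def)

lemma word_cong_in_signed_words:
  assumes "presentation S R" "(w, w') \<in> word_cong S R"
  shows "w \<in> signed_words S \<and> w' \<in> signed_words S"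
  using assms(2,1)
  by (induction rule: word_cong.induct) (auto simp: presentation_def intro!: pos_in_signed_words)

lemma equiv_word_cong:
  assumes "presentation S R"
  shows "equiv (signed_words S) (word_cong S R)"
proof (rule equivI)
  show "word_cong S R \<subseteq> signed_words S \<times> signed_words S"
    using word_cong_in_signed_words[OF assms] by auto
  show "refl_on (signed_words S) (word_cong S R)"
    by (auto simp: refl_on_def intro: word_cong.refl)
  show "sym (word_cong S R)"
    by (auto simp: sym_def intro: word_cong.sym)
  show "trans (word_cong S R)"
    by (auto simp: trans_def intro: word_cong.trans)
qed

lemma word_class_eq_iff:
  assumes "presentation S R" "w \<in> signed_words S" "w' \<in> signed_words S"
  shows "word_class S R w = word_class S R w' \<longleftrightarrow> (w, w') \<in> word_cong S R"
  unfolding word_class_def using eq_equiv_class_iff[OF equiv_word_cong] assms by blast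

lemma carrier_presented_group: "carrier (presented_group S R) = word_class S R ` signed_words S"
  by (auto simp: presented_group_def word_class_def quotient_def)

lemma mult_presented_group:
  assumes R: "presentation S R" and "w \<in> signed_words S" "z \<in> signed_words S"
  shows "word_class S R w \<otimes>\<^bsub>presented_group S R\<^esub> word_class S R z = word_class S R (w @ z)"
proof -
  have "word_class S R (u @ v) = word_class S R (w @ z)"
    if "u \<in> word_class S R w" "v \<in> word_class S R z" for u v
  proof -
    have uv: "(w, u) \<in> word_cong S R" "(z, v) \<in> word_cong S R"
      using that by (auto simp: word_class_def)
    then have "(w @ z, u @ v) \<in> word_cong S R" by (rule word_cong.append)
    then show ?thesis
      using word_cong_in_signed_words[OF R uv(1)] word_cong_in_signed_words[OF R uv(2)]
      by (subst word_class_eq_iff[OF R]) (auto intro: word_cong.sym)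
  qed
  then have "(\<Union>u\<in>word_class S R w. \<Union>v\<in>word_class S R z. word_class S R (u @ v)) =
      (\<Union>u\<in>word_class S R w. \<Union>v\<in>word_class S R z. word_class S R (w @ z))"
    by (intro SUP_cong) auto
  moreover have "w \<in> word_class S R w" "z \<in> word_class S R z"
    using assms by (auto simp: word_class_def intro: word_cong.refl)
  ultimately show ?thesis
    unfolding presented_group_def by simp blast
qed

lemma word_inv_cong:
  "w \<in> signed_words S \<Longrightarrow> (word_inv w @ w, []) \<in> word_cong S R"
proof (induction w)
  case Nil
  then show ?case by (auto simp: word_inv_def intro: word_cong.refl)
next
  case (Cons a w)
  have a: "([letter_inv a, a], []) \<in> word_cong S R"
    using Cons.prems by (auto intro: word_cong.cancel_left word_cong.cancel_right)
  have w: "w \<in> signed_words S" using Cons.prems by simp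
  have "(word_inv w @ [letter_inv a, a] @ w, word_inv w @ [] @ w) \<in> word_cong S R"
    by (intro word_cong.append a word_cong.refl w word_inv_in_signed_words)
  then have "(word_inv w @ [letter_inv a, a] @ w, []) \<in> word_cong S R"
    using Cons.IH[OF w] by (auto intro: word_cong.trans)
  then show ?case by (simp add: word_inv_def)
qed

lemma group_presented_group:
  assumes R: "presentation S R"
  shows "group (presented_group S R)"
proof (rule groupI)
  have one: "\<one>\<^bsub>presented_group S R\<^esub> = word_class S R []"
    by (simp add: presented_group_def)
  show "\<one>\<^bsub>presented_group S R\<^esub> \<in> carrier (presented_group S R)"
    by (auto simp: one carrier_presented_group)
  show "\<exists>y\<in>carrier (presented_group S R). y \<otimes>\<^bsub>presented_group S R\<^esub> x = \<one>\<^bsub>presented_group S R\<^esub>"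
    if "x \<in> carrier (presented_group S R)" for x
  proof -
    obtain w where w: "w \<in> signed_words S" "x = word_class S R w"
      using \<open>x \<in> _\<close> by (auto simp: carrier_presented_group)
    have "word_class S R (word_inv w) \<otimes>\<^bsub>presented_group S R\<^esub> x = \<one>\<^bsub>presented_group S R\<^esub>"
      using w word_inv_in_signed_words[OF w(1)] word_inv_cong[OF w(1)]
      by (simp add: mult_presented_group[OF R] one word_class_eq_iff[OF R])
    then show ?thesis
      using word_inv_in_signed_words[OF w(1)] by (auto simp: carrier_presented_group)
  qed
  show "\<one>\<^bsub>presented_group S R\<^esub> \<otimes>\<^bsub>presented_group S R\<^esub> x = x"
    if "x \<in> carrier (presented_group S R)" for x
    using that by (auto simp: carrier_presented_group one mult_presented_group[OF R])
qed (auto simp: carrier_presented_group mult_presented_group[OF R])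

primrec eval_letter :: "('g, 'm) monoid_scheme \<Rightarrow> ('a \<Rightarrow> 'g) \<Rightarrow> 'a letter \<Rightarrow> 'g" where
  "eval_letter G f (Pos s) = f s"
| "eval_letter G f (Neg s) = inv\<^bsub>G\<^esub> (f s)"

definition eval_word :: "('g, 'm) monoid_scheme \<Rightarrow> ('a \<Rightarrow> 'g) \<Rightarrow> 'a letter list \<Rightarrow> 'g" where
  "eval_word G f w = foldr (\<lambda>a g. eval_letter G f a \<otimes>\<^bsub>G\<^esub> g) w \<one>\<^bsub>G\<^esub>"

context
  fixes G :: "('g, 'm) monoid_scheme" and f :: "'a \<Rightarrow> 'g" and S :: "'a set"
  assumes G: "group G" and f: "f \<in> S \<rightarrow> carrier G"
begin

interpretation group G by (rule G)

lemma eval_letter_closed: "a \<in> Pos ` S \<union> Neg ` S \<Longrightarrow> eval_letter G f a \<in> carrier G"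
  using f by (auto simp: Pi_iff)

lemma eval_word_closed: "w \<in> signed_words S \<Longrightarrow> eval_word G f w \<in> carrier G"
proof (induction w)
  case (Cons a w)
  then show ?case using eval_letter_closed[of a] by (simp add: eval_word_def)
qed (simp add: eval_word_def)

lemma eval_word_append:
  "w \<in> signed_words S \<Longrightarrow> z \<in> signed_words S \<Longrightarrow>
   eval_word G f (w @ z) = eval_word G f w \<otimes>\<^bsub>G\<^esub> eval_word G f z"
proof (induction w)
  case Nil
  then show ?case using eval_word_closed[OF Nil(2)] by (simp add: eval_word_def)
next
  case (Cons a w)
  then show ?case
    using eval_letter_closed[of a] eval_word_closed[of w] eval_word_closed[of z]
    by (auto simp: eval_word_def m_assoc)
qed

lemma eval_word_cong:
  assumes R: "presentation S R"
    and rels: "\<And>v v'. (v, v') \<in> R \<Longrightarrow> eval_word G f (pos v) = eval_word G f (pos v')"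
    and "(w, w') \<in> word_cong S R"
  shows "eval_word G f w = eval_word G f w'"
  using assms(3)
proof (induction rule: word_cong.induct)
  case (append w w' z z')
  then show ?case
    using word_cong_in_signed_words[OF R append.hyps(1)] word_cong_in_signed_words[OF R append.hyps(2)]
    by (simp add: eval_word_append)
next
  case (cancel_right s)
  then have "f s \<in> carrier G" using f by auto
  then show ?case by (simp add: eval_word_def)
next
  case (cancel_left s)
  then have "f s \<in> carrier G" using f by auto
  then show ?case by (simp add: eval_word_def)
qed (use rels in auto)

lemma presented_group_universal:
  assumes R: "presentation S R"
    and rels: "\<And>v v'. (v, v') \<in> R \<Longrightarrow> eval_word G f (pos v) = eval_word G f (pos v')"
  shows "\<exists>h \<in> hom (presented_group S R) G. \<forall>s\<in>S. h (word_class S R [Pos s]) = f s"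
proof -
  define h where "h A = eval_word G f (SOME w. w \<in> A)" for A
  have h: "h (word_class S R w) = eval_word G f w" if "w \<in> signed_words S" for w
  proof -
    have "w \<in> word_class S R w" using that by (auto simp: word_class_def intro: word_cong.refl)
    then have "(SOME z. z \<in> word_class S R w) \<in> word_class S R w" by (rule someI)
    then show ?thesis
      using eval_word_cong[OF R rels] by (auto simp: h_def word_class_def)
  qed
  have "h \<in> hom (presented_group S R) G"
    by (rule homI)
       (auto simp: carrier_presented_group h mult_presented_group[OF R] eval_word_append eval_word_closed)
  moreover have "h (word_class S R [Pos s]) = f s" if "s \<in> S" for s
    using that f by (subst h) (auto simp: eval_word_def Pi_iff)
  ultimately show ?thesis by blast
qed

end

lemma presented_group_generated:
  assumes R: "presentation S R" and G: "group G"
    and h: "h \<in> hom (presented_group S R) G" and k: "k \<in> hom (presented_group S R) G"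
    and hk: "\<And>s. s \<in> S \<Longrightarrow> h (word_class S R [Pos s]) = k (word_class S R [Pos s])"
    and x: "x \<in> carrier (presented_group S R)"
  shows "h x = k x"
proof -
  let ?P = "presented_group S R"
  interpret h: group_hom ?P G h
    using h G group_presented_group[OF R] by (simp add: group_hom_def group_hom_axioms_def)
  interpret k: group_hom ?P G k
    using k G group_presented_group[OF R] by (simp add: group_hom_def group_hom_axioms_def)
  have cl: "word_class S R w \<in> carrier ?P" if "w \<in> signed_words S" for w
    using that by (auto simp: carrier_presented_group)
  have one: "\<one>\<^bsub>?P\<^esub> = word_class S R []"
    by (simp add: presented_group_def)
  have neg: "word_class S R [Neg s] = inv\<^bsub>?P\<^esub> (word_class S R [Pos s])" if "s \<in> S" for s
  proof -
    have "word_class S R [Neg s] \<otimes>\<^bsub>?P\<^esub> word_class S R [Pos s] = \<one>\<^bsub>?P\<^esub>"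
      using that word_cong.cancel_left[OF that]
      by (simp add: mult_presented_group[OF R] one word_class_eq_iff[OF R])
    then show ?thesis
      using that cl[of "[Neg s]"] cl[of "[Pos s]"] h.G.inv_equality[of "word_class S R [Neg s]"] by auto
  qed
  have letter: "h (word_class S R [a]) = k (word_class S R [a])" if "a \<in> Pos ` S \<union> Neg ` S" for a
    using that hk neg cl[of "[Pos _]"] by (auto simp: h.hom_inv k.hom_inv)
  have "h (word_class S R w) = k (word_class S R w)" if "w \<in> signed_words S" for w
    using that
  proof (induction w)
    case Nil
    then show ?case using h.hom_one k.hom_one by (simp add: one)
  next
    case (Cons a w)
    then have "word_class S R (a # w) = word_class S R [a] \<otimes>\<^bsub>?P\<^esub> word_class S R w"
      by (simp add: mult_presented_group[OF R])
    moreover have "word_class S R [a] \<in> carrier ?P" "word_class S R w \<in> carrier ?P"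
      using Cons.prems by (auto intro!: cl)
    ultimately show ?case
      using Cons letter[of a] by (simp add: h.hom_mult k.hom_mult)
  qed
  then show ?thesis using x by (auto simp: carrier_presented_group)
qed

end

theory Submission
  imports Defs
begin

text \<open>Over a right-angled presentation the special transformations contain two elementary moves:
  exchanging adjacent letters \<open>a\<close>, \<open>b\<close> (of any signs) whose generators commute, and deleting
  a factor \<open>a a\<inverse>\<close> (of either sign). It suffices to show that the set of words that
  these moves reduce to \<open>\<epsilon>\<close> is saturated for the congruence defining the group, and the
  only nontrivial point is that inserting a pair \<open>a a\<inverse>\<close> can be undone: if
  \<open>p a a\<inverse> r\<close> reduces to \<open>\<epsilon>\<close>, so does \<open>p r\<close>.

  To prove this, follow the two inserted letters along the reduction. As long as both survive, the
  current word has the form \<open>p a q a\<inverse> r\<close> where every letter of \<open>q\<close> commutes with \<open>a\<close>,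
  and any move on it is matched by at most one move on the word \<open>p q r\<close> without the marked
  letters (\<open>move_marked_pair\<close>). Since \<open>\<epsilon>\<close> contains no marked letters, one of them is
  eventually cancelled. If the two cancel each other, what remains is \<open>p q r\<close>.
  Otherwise a marked letter cancels against an equal copy of the other one, which then takes the
  place of that one up to commuting it past \<open>q\<close>. In either case \<open>p q r\<close> reduces to the
  word obtained, hence to \<open>\<epsilon>\<close>.\<close>

text \<open>The generator underlying a letter.\<close>

primrec gen :: "'a letter \<Rightarrow> 'a" where
  "gen (Pos s) = s"
| "gen (Neg s) = s"

text \<open>Two letters, of any signs, commute if the commutation of their generators is a relation.
  Nothing here makes a letter commute with itself; over a right-angled presentation it never does.\<close>

definition letters_commute :: "('a list \<times> 'a list) set \<Rightarrow> 'a letter \<Rightarrow> 'a letter \<Rightarrow> bool" where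
  "letters_commute R a b \<longleftrightarrow> is_relation R [gen a, gen b] [gen b, gen a]"

text \<open>The elementary moves. They make sense for letters outside the alphabet as well, which keeps
  membership side conditions out of the combinatorics.\<close>

inductive move :: "('a list \<times> 'a list) set \<Rightarrow> 'a letter list \<Rightarrow> 'a letter list \<Rightarrow> bool" for R where
  swap: "letters_commute R a b \<Longrightarrow> move R (x @ a # b # y) (x @ b # a # y)"
| cancel: "move R (x @ a # letter_inv a # y) (x @ y)"

abbreviation moves :: "('a list \<times> 'a list) set \<Rightarrow> 'a letter list \<Rightarrow> 'a letter list \<Rightarrow> bool" where
  "moves R \<equiv> (move R)\<^sup>*\<^sup>*"

lemma letter_inv_letter_inv [simp]: "letter_inv (letter_inv a) = a"
  by (cases a) auto

lemma gen_letter_inv [simp]: "gen (letter_inv a) = gen a"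
  by (cases a) auto

lemma letters_commute_sym: "letters_commute R a b \<Longrightarrow> letters_commute R b a"
  by (auto simp: letters_commute_def is_relation_def)

lemma letters_commute_letter_inv [simp]:
  "letters_commute R (letter_inv a) b \<longleftrightarrow> letters_commute R a b"
  "letters_commute R a (letter_inv b) \<longleftrightarrow> letters_commute R a b"
  by (simp_all add: letters_commute_def)

lemma not_letters_commute_self:
  assumes "right_angled_artin_tits S R"
  shows "\<not> letters_commute R a a"
  using assms by (auto simp: letters_commute_def is_relation_def right_angled_artin_tits_def)

section \<open>Reductions by elementary moves\<close>

lemma moves_left:
  "\<forall>b\<in>set q. letters_commute R a b \<Longrightarrow> moves R (x @ q @ a # y) (x @ a # q @ y)"
proof (induction q arbitrary: x)
  case (Cons b q)
  have "moves R ((x @ [b]) @ q @ a # y) ((x @ [b]) @ a # q @ y)"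
    using Cons.prems by (intro Cons.IH) auto
  moreover have "move R (x @ b # a # q @ y) (x @ a # b # q @ y)"
    using Cons.prems by (auto intro: swap letters_commute_sym)
  ultimately show ?case by (simp add: rtranclp.rtrancl_into_rtrancl)
qed auto

lemma moves_right:
  "\<forall>b\<in>set q. letters_commute R a b \<Longrightarrow> moves R (x @ a # q @ y) (x @ q @ a # y)"
proof (induction q arbitrary: x)
  case (Cons b q)
  have "move R (x @ a # b # q @ y) (x @ b # a # q @ y)"
    using Cons.prems by (auto intro: swap)
  moreover have "moves R ((x @ [b]) @ a # q @ y) ((x @ [b]) @ q @ a # y)"
    using Cons.prems by (intro Cons.IH) auto
  ultimately show ?case by (simp add: converse_rtranclp_into_rtranclp)
qed auto

text \<open>The position of an adjacent pair \<open>c d\<close> relative to a marked letter \<open>a\<close>.\<close>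

lemma adjacent_pair_cases:
  assumes "x @ c # d # y = p @ a # s"
  obtains (before) m where "p = x @ c # d # m" "y = m @ a # s"
  | (right) "p = x @ [c]" "d = a" "y = s"
  | (left) "p = x" "c = a" "s = d # y"
  | (after) m where "x = p @ a # m" "s = m @ c # d # y"
  using assms
  by (auto simp: append_eq_append_conv2 append_eq_Cons_conv Cons_eq_append_conv)

text \<open>The second alternative of the conclusion is the survival of both marked letters; the first
  covers the moves that cancel at least one of them.\<close>

lemma move_marked_pair:
  assumes irrefl: "\<And>b. \<not> letters_commute R b b"
    and q: "\<forall>b\<in>set q. letters_commute R a b"
    and step: "move R (p @ a # q @ letter_inv a # r) w"
  shows "moves R (p @ q @ r) w \<or>
    (\<exists>p' q' r'. w = p' @ a # q' @ letter_inv a # r' \<and> (\<forall>b\<in>set q'. letters_commute R a b) \<and>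
       moves R (p @ q @ r) (p' @ q' @ r'))"
    (is "?cancelled \<or> ?survives")
proof -
  have survives: ?survives
    if "w = p' @ a # q' @ letter_inv a # r'" "\<forall>b\<in>set q'. letters_commute R a b"
      "moves R (p @ q @ r) (p' @ q' @ r')" for p' q' r'
    using that by blast
  have no_inv: "\<not> letters_commute R a (letter_inv a)"
    using irrefl by simp
  from step show ?thesis
  proof cases
    case (swap c d x y)
    note cd = swap(3)
    from swap(1)[symmetric] show ?thesis
    proof (cases rule: adjacent_pair_cases)
      case (before m)
      have "move R (x @ c # d # m @ q @ r) (x @ d # c # m @ q @ r)"
        using cd by (rule move.swap)
      then show ?thesis
        using survives[of "x @ d # c # m" q r] before swap(2) q by auto
    next
      case right
      then show ?thesis
        using survives[of x "c # q" r] swap(2) q letters_commute_sym[OF cd] by auto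
    next
      case left
      show ?thesis
      proof (cases q)
        case Nil
        then show ?thesis using left cd no_inv by auto
      next
        case (Cons e q')
        then show ?thesis
          using survives[of "p @ [d]" q' r] left swap(2) q by auto
      qed
    next
      case (after m)
      from after(2)[symmetric] show ?thesis
      proof (cases rule: adjacent_pair_cases)
        case (before m')
        have "move R ((p @ m) @ c # d # m' @ r) ((p @ m) @ d # c # m' @ r)"
          using cd by (rule move.swap)
        then show ?thesis
          using survives[of p "m @ d # c # m'" r] before after swap(2) q by auto
      next
        case right
        then show ?thesis
          using survives[of p m "c # r"] after swap(2) q by auto
      next
        case left
        then show ?thesis
          using survives[of p "m @ [d]" y] after swap(2) q cd by auto
      next
        case (after m')
        have "move R ((p @ q @ m') @ c # d # y) ((p @ q @ m') @ d # c # y)"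
          using cd by (rule move.swap)
        then show ?thesis
          using survives[of p q "m' @ d # c # y"] after \<open>x = p @ a # m\<close> swap(2) q by auto
      qed
    qed
  next
    case (cancel x c y)
    from cancel(1)[symmetric] show ?thesis
    proof (cases rule: adjacent_pair_cases)
      case (before m)
      have "move R (x @ c # letter_inv c # m @ q @ r) (x @ m @ q @ r)"
        by (rule move.cancel)
      then show ?thesis
        using survives[of "x @ m" q r] before cancel(2) q by auto
    next
      \<comment> \<open>The marked \<open>a\<close> cancels against a copy of \<open>a\<inverse>\<close>, the last letter of \<open>p\<close>.\<close>
      case right
      then have "letter_inv a = c" by auto
      moreover from this have "\<forall>b\<in>set q. letters_commute R c b"
        using q letters_commute_letter_inv(1) by metis
      then have "moves R (x @ c # q @ r) (x @ q @ c # r)"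
        by (rule moves_right)
      ultimately show ?thesis using right cancel(2) by simp
    next
      case left
      show ?thesis
      proof (cases q)
        case Nil
        then show ?thesis using left cancel(2) by auto
      next
        case (Cons e q')
        then show ?thesis using left q no_inv by auto
      qed
    next
      case (after m)
      from after(2)[symmetric] show ?thesis
      proof (cases rule: adjacent_pair_cases)
        case (before m')
        have "move R ((p @ m) @ c # letter_inv c # m' @ r) ((p @ m) @ m' @ r)"
          by (rule move.cancel)
        then show ?thesis
          using survives[of p "m @ m'" r] before after cancel(2) q by auto
      next
        case right
        then have "c = a" by (metis letter_inv_letter_inv)
        then show ?thesis using right q irrefl by auto
      next
        \<comment> \<open>The marked \<open>a\<inverse>\<close> cancels against a copy of \<open>a\<close>, the first letter of \<open>r\<close>.\<close>
        case left
        then show ?thesis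
          using after cancel(2) moves_left[OF q, of p y] by auto
      next
        case (after m')
        have "move R ((p @ q @ m') @ c # letter_inv c # y) ((p @ q @ m') @ y)"
          by (rule move.cancel)
        then show ?thesis
          using survives[of p q "m' @ y"] after \<open>x = p @ a # m\<close> cancel(2) q by auto
      qed
    qed
  qed
qed

lemma moves_Nil_remove_marked_pair:
  assumes irrefl: "\<And>b. \<not> letters_commute R b b"
    and "moves R (p @ a # q @ letter_inv a # r) []"
    and "\<forall>b\<in>set q. letters_commute R a b"
  shows "moves R (p @ q @ r) []"
proof -
  have "moves R (p @ q @ r) []"
    if "moves R w []" "w = p @ a # q @ letter_inv a # r" "\<forall>b\<in>set q. letters_commute R a b" for w p q r
    using that
  proof (induction arbitrary: p q r rule: converse_rtranclp_induct)
    case (step w w')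
    have "move R (p @ a # q @ letter_inv a # r) w'"
      using step.hyps(1) step.prems(1) by simp
    then consider "moves R (p @ q @ r) w'"
      | p' q' r' where "w' = p' @ a # q' @ letter_inv a # r'" "\<forall>b\<in>set q'. letters_commute R a b"
        "moves R (p @ q @ r) (p' @ q' @ r')"
      using move_marked_pair[OF irrefl step.prems(2)] by blast
    then show ?case
    proof cases
      case 1
      then show ?thesis using step.hyps(2) by simp
    next
      case 2
      then show ?thesis using step.IH[OF 2(1,2)] by simp
    qed
  qed simp
  then show ?thesis using assms by blast
qed

lemma moves_Nil_cancel_iff:
  assumes "\<And>b. \<not> letters_commute R b b"
  shows "moves R (x @ a # letter_inv a # y) [] \<longleftrightarrow> moves R (x @ y) []"
  using moves_Nil_remove_marked_pair[OF assms, of x a "[]" y] move.cancel[of R x a y]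
  by (auto intro: converse_rtranclp_into_rtranclp)

lemma moves_Nil_swap_iff:
  assumes "letters_commute R a b"
  shows "moves R (x @ a # b # y) [] \<longleftrightarrow> moves R (x @ b # a # y) []"
  using move.swap[OF assms, of x y] move.swap[OF letters_commute_sym[OF assms], of x y]
  by (auto intro: converse_rtranclp_into_rtranclp)

text \<open>The context \<open>x\<close>, \<open>y\<close> is what makes the induction pass through concatenation.\<close>

lemma word_cong_moves_Nil_iff:
  assumes raat: "right_angled_artin_tits S R" and "(w, w') \<in> word_cong S R"
  shows "moves R (x @ w @ y) [] \<longleftrightarrow> moves R (x @ w' @ y) []"
  using assms(2)
proof (induction arbitrary: x y rule: word_cong.induct)
  case (append w w' z z')
  then show ?case
    using append.IH(1)[of x "z @ y"] append.IH(2)[of "x @ w'" y] by simp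
next
  case (rel v v')
  then obtain s t where "v = [s, t]" "v' = [t, s]" "letters_commute R (Pos s) (Pos t)"
    using raat by (auto simp: right_angled_artin_tits_def letters_commute_def is_relation_def)
  then show ?case
    using moves_Nil_swap_iff[of R "Pos s" "Pos t" x y] by simp
next
  case (cancel_right s)
  show ?case
    using moves_Nil_cancel_iff[OF not_letters_commute_self[OF raat], of x "Pos s" y] by simp
next
  case (cancel_left s)
  show ?case
    using moves_Nil_cancel_iff[OF not_letters_commute_self[OF raat], of x "Neg s" y] by simp
qed auto

section \<open>Elementary moves as special transformations\<close>

text \<open>A swap is of type 1 for letters of equal sign and of type 2 for letters of opposite signs.\<close>

lemma move_imp_special_step:
  assumes "move R w w'" "w \<in> signed_words S"
  shows "special_step S R w w'"
  using assms
proof cases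
  case (swap a b x y)
  then have x: "x \<in> signed_words S" and y: "y \<in> signed_words S"
    using assms(2) by auto
  show ?thesis
  proof (cases a; cases b)
    fix s t
    assume ab: "a = Pos s" "b = Pos t"
    then have "is_relation R [s, t] [t, s]"
      using swap(3) by (simp add: letters_commute_def)
    from type1_pos[OF this x y] show ?thesis
      using swap ab by simp
  next
    fix s t
    assume ab: "a = Neg s" "b = Neg t"
    then have "is_relation R [t, s] [s, t]"
      using swap(3) by (auto simp: letters_commute_def is_relation_def)
    from type1_neg[OF this x y] show ?thesis
      using swap ab by (simp add: word_inv_def)
  next
    fix s t
    assume ab: "a = Neg s" "b = Pos t"
    then have "s \<in> S" "t \<in> S" "is_relation R ([s] @ [t]) ([t] @ [s])"
      using swap(1,3) assms(2) by (auto simp: letters_commute_def)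
    then show ?thesis
      using type2_right[of "[s]" S "[t]" R "[t]" "[s]" x y] x y swap ab
      by (simp add: word_inv_def)
  next
    fix s t
    assume ab: "a = Pos s" "b = Neg t"
    then have "s \<in> S" "t \<in> S" "is_relation R ([t] @ [s]) ([s] @ [t])"
      using swap(1,3) assms(2) by (auto simp: letters_commute_def is_relation_def)
    then show ?thesis
      using type2_left[of "[s]" S "[t]" R "[t]" "[s]" x y] x y swap ab
      by (simp add: word_inv_def)
  qed
next
  case (cancel x a y)
  then have x: "x \<in> signed_words S" and y: "y \<in> signed_words S" and a: "gen a \<in> S"
    using assms(2) by (auto simp: image_iff)
  show ?thesis
    using type0_right[OF a x y] type0_left[OF a x y] cancel by (cases a) simp_all
qed

lemma move_in_signed_words:
  "move R w w' \<Longrightarrow> w \<in> signed_words S \<Longrightarrow> w' \<in> signed_words S"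
  by (induction rule: move.induct) auto

lemma moves_imp_special_reduces:
  assumes "moves R w w'" "w \<in> signed_words S"
  shows "special_reduces S R w w'"
  using assms
proof (induction rule: converse_rtranclp_induct)
  case (step w z)
  then show ?case
    using move_imp_special_step[of R w z S] move_in_signed_words[of R w z S]
    by (auto simp: special_reduces_def intro: converse_rtranclp_into_rtranclp)
qed (simp add: special_reduces_def)

theorem proposition3p1:
  fixes S :: "'a set" and R :: "('a list \<times> 'a list) set"
  assumes "right_angled_artin_tits S R"
  shows "property_H S R"
  unfolding property_H_def
proof (intro ballI impI)
  fix w
  assume w: "w \<in> signed_words S" and "represents_one S R w"
  then have "(w, []) \<in> word_cong S R"
    using word_class_eq_iff[OF right_angled_artin_tits_presentation[OF assms] w]
    by (simp add: represents_one_def presented_group_def)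
  then have "moves R w []"
    using word_cong_moves_Nil_iff[OF assms, of w "[]" "[]" "[]"] by simp
  then show "special_reduces S R w []"
    using w by (rule moves_imp_special_reduces)
qed

end
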